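(* Let $g\colon\mathbb{R}\setminus\{0\}\to\mathbb{R}$ be such that its restriction $g|_{\mathbb{R}_+}$ lies in $\mathcal{D}^0\cap\mathcal{K}^0$ and let $\omega\colon\mathbb{R}\setminus\mathbb{Z}\to\mathbb{R}$ be the function defined by $$\omega(x)=\Sigma g(x)-\Sigma g(1-x)\qquad\text{for }x\in\mathbb{R}\setminus\mathbb{Z}.$$ Then the following assertions are equivalent. (i) The function $g|_{\mathbb{R}\setminus\mathbb{Z}}$ is odd. (ii) The function $\omega$ is $1$-periodic. (iii) We have that $g|_{\mathbb{R}\setminus\mathbb{Z}}$ vanishes at $-\infty$ (i.e., $g(x)\to0$ as $x\to-\infty$ with $x\in\mathbb{R}\setminus\mathbb{Z}$) and $$\omega(x)=-\lim_{N\to\infty}\sum_{|k|\le N}g(x+k),\qquad x\in\mathbb{R}\setminus\mathbb{Z}.$$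
   Context: $\mathbb{N}=\{0,1,2,\ldots\}$, $\mathbb{R}_+=(0,\infty)$. $\mathcal{K}^0$ is the set of functions $\mathbb{R}_+\to\mathbb{R}$ that are monotone (increasing or decreasing in the wide sense) on some $[a,\infty)$, and $\mathcal{D}^0$ is the set of functions $g\colon\mathbb{R}_+\to\mathbb{R}$ with $g(n)\to0$ as $n\to\infty$ over the integers. For $g\colon\mathbb{R}\setminus\{0\}\to\mathbb{R}$ with $g|_{\mathbb{R}_+}\in\mathcal{D}^0\cap\mathcal{K}^0$, the function $\Sigma g\colon\mathbb{R}\setminus(-\mathbb{N})\to\mathbb{R}$ is defined by $$\Sigma g(x)=\lim_{n\to\infty}\Big(-g(x)+\sum_{k=1}^{n-1}(g(k)-g(x+k))\Big),\qquad x\in\mathbb{R}\setminus(-\mathbb{N});$$ the limit exists, and $\Sigma g$ is the unique function $f$ on $\mathbb{R}\setminus(-\mathbb{N})$ satisfying $f(x+1)-f(x)=g(x)$ whose restriction to $\mathbb{R}_+$ is the eventually monotone solution of that equation on $\mathbb{R}_+$ vanishing at $1$. *)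

theory Defs
  imports Complex_Main
begin

text \<open>
  Partial functions are represented by total functions \<open>real \<Rightarrow> real\<close>; the values outside the
  intended domain are arbitrary and never matter.  In particular membership in \<open>K0\<close> and \<open>D0\<close>
  depends only on the values on the open half-line of positive reals, so \<open>g \<in> D0 \<inter> K0\<close>
  is a condition on the restriction of \<open>g\<close> to that half-line.
\<close>

definition K0 :: "(real \<Rightarrow> real) set" where
  "K0 = {g. \<exists>a>0. mono_on {a..} g \<or> antimono_on {a..} g}"

definition D0 :: "(real \<Rightarrow> real) set" where
  "D0 = {g. (\<lambda>n::nat. g (real n)) \<longlonglongrightarrow> 0}"

text \<open>
  \<open>Sigma_op g x\<close> is meaningful for \<open>x\<close> not in \<open>{0, -1, -2, \<dots>}\<close>; then \<open>g\<close> is never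
  evaluated at \<open>0\<close>.
\<close>

definition Sigma_op :: "(real \<Rightarrow> real) \<Rightarrow> real \<Rightarrow> real" where
  "Sigma_op g x =
     lim (\<lambda>n::nat. - g x + (\<Sum>k\<in>{1..<n}. g (real k) - g (x + real k)))"

end

theory Submission
  imports Defs
begin

text \<open>
  Everything rests on one formula, \<open>Sigma_op_diff_sums\<close>:
  \<open>\<Sigma>g(x) - \<Sigma>g(y) = lim\<^sub>n \<Sum>k<n. (g(y+k) - g(x+k))\<close>,
  in which the normalising terms \<open>g(k)\<close> have cancelled. It is available as soon as the limits
  defining \<open>\<Sigma>g\<close> exist, and they do because \<open>g\<close> is eventually monotone and tends to \<open>0\<close>:
  the terms \<open>g(k) - g(x+k)\<close> are dominated by increments of \<open>g\<close>, whose sum telescopes.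

  Comparing \<open>x+1\<close> with \<open>x\<close>, the formula telescopes to \<open>\<Sigma>g(x+1) - \<Sigma>g(x) = g(x)\<close>. Applied to
  both terms of \<open>\<omega>\<close> this gives \<open>\<omega>(x+1) - \<omega>(x) = g(x) + g(-x)\<close>, so oddness of \<open>g\<close> off the integers
  and periodicity of \<open>\<omega>\<close> are the same condition.

  Comparing \<open>x\<close> with \<open>1-x\<close>, it expresses \<open>-\<omega>(x)\<close> as the limit of
  \<open>\<Sum>k<n. (g(x+k) - g(1-x+k))\<close>. If \<open>g\<close> is odd off the integers, then \<open>-g(1-x+k) = g(x-1-k)\<close>, and these are the
  terms of the bilateral sum with negative index. Conversely, replacing \<open>x\<close> by \<open>x+1\<close> changes the
  symmetric partial sum only at its two ends, by \<open>g(x+N+1) - g(x-N)\<close>; if \<open>g\<close> vanishes at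
  \<open>-\<infinity>\<close> as well as at \<open>\<infinity>\<close>, the limit is therefore periodic.
\<close>

section \<open>Decay and summability for eventually monotone functions\<close>

lemma tendsto_at_top_if_mono_on:
  fixes g :: "real \<Rightarrow> real"
  assumes mono: "mono_on {a..} g" and lim: "(\<lambda>n::nat. g (real n)) \<longlonglongrightarrow> l"
  shows "(g \<longlongrightarrow> l) at_top"
proof (rule tendsto_sandwich)
  have floor: "filterlim (\<lambda>x::real. nat \<lfloor>x\<rfloor>) sequentially at_top"
    by (intro filterlim_compose[OF filterlim_nat_sequentially] filterlim_floor_sequentially)
  have ceiling: "filterlim (\<lambda>x::real. nat \<lceil>x\<rceil>) sequentially at_top"
    by (rule filterlim_at_top_mono[OF floor], intro always_eventually) linarith
  show "((\<lambda>x::real. g (real (nat \<lfloor>x\<rfloor>))) \<longlongrightarrow> l) at_top"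
    using filterlim_compose[OF lim floor] .
  show "((\<lambda>x::real. g (real (nat \<lceil>x\<rceil>))) \<longlongrightarrow> l) at_top"
    using filterlim_compose[OF lim ceiling] .
  show "\<forall>\<^sub>F x in at_top. g (real (nat \<lfloor>x\<rfloor>)) \<le> g x"
    using eventually_ge_at_top[of "max 0 (a + 1)"]
    by eventually_elim (intro mono_onD[OF mono]; simp; linarith)
  show "\<forall>\<^sub>F x in at_top. g x \<le> g (real (nat \<lceil>x\<rceil>))"
    using eventually_ge_at_top[of "max 0 (a + 1)"]
    by eventually_elim (intro mono_onD[OF mono]; simp; linarith)
qed

lemma summable_increment:
  fixes h :: "nat \<Rightarrow> real"
  assumes "h \<longlonglongrightarrow> l"
  shows "summable (\<lambda>k. h (k + j) - h k)"
proof (induction j)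
  case (Suc j)
  have "summable (\<lambda>k. h (Suc k + j) - h (k + j))"
    by (rule telescope_summable[where f = "\<lambda>k. h (k + j)"]) (rule LIMSEQ_ignore_initial_segment[OF assms])
  from summable_add[OF Suc this] show ?case by simp
qed simp

text \<open>
  With an integer \<open>m \<ge> \<bar>x\<bar>\<close>, monotonicity makes \<open>g(k-m)\<close> and \<open>g(k+m)\<close> bracket both
  \<open>g(k)\<close> and \<open>g(x+k)\<close> for large \<open>k\<close>, so the general term is in absolute value at most the increment \<open>g(k+m) - g(k-m)\<close>.
\<close>

lemma summable_shift_diff_if_mono_on:
  fixes g :: "real \<Rightarrow> real"
  assumes mono: "mono_on {a..} g" and lim: "(\<lambda>n::nat. g (real n)) \<longlonglongrightarrow> l"
  shows "summable (\<lambda>k. g (real k) - g (x + real k))"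
proof -
  obtain m :: nat where m: "\<bar>x\<bar> \<le> real m" using real_arch_simple by blast
  \<comment> \<open>From \<open>N\<close> on, the left end \<open>k-m\<close> lies in the range where \<open>g\<close> is monotone.\<close>
  obtain N :: nat where N: "a + real m \<le> real N" using real_arch_simple by blast
  define h where "h k = g (real k - real m)" for k :: nat
  have "h \<longlonglongrightarrow> l"
    by (rule LIMSEQ_offset[of _ m]) (simp add: h_def lim)
  then have "summable (\<lambda>k. h (k + 2 * m) - h k)" by (rule summable_increment)
  then show ?thesis
  proof (rule summable_comparison_test'[of _ N])
    fix k assume "N \<le> k"
    then have k: "a + real m \<le> real k" using N by linarith
    have *: "h k \<le> g y \<and> g y \<le> h (k + 2 * m)" if "\<bar>y - real k\<bar> \<le> real m" for y
      unfolding h_def using that k by (intro conjI mono_onD[OF mono]) auto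
    show "norm (g (real k) - g (x + real k)) \<le> h (k + 2 * m) - h k"
      using *[of "real k"] *[of "x + real k"] m by auto
  qed
qed

lemma mono_on_uminus_if_antimono_on:
  fixes g :: "real \<Rightarrow> real"
  shows "antimono_on A g \<Longrightarrow> mono_on A (\<lambda>x. - g x)"
  by (auto simp: monotone_on_def)

lemma
  assumes "g \<in> D0 \<inter> K0"
  shows D0_K0_tendsto_0: "(g \<longlongrightarrow> 0) at_top"
    and D0_K0_summable: "summable (\<lambda>k. g (real k) - g (x + real k))"
proof -
  obtain a where a: "mono_on {a..} g \<or> antimono_on {a..} g"
    using assms by (auto simp: K0_def)
  have lim: "(\<lambda>n::nat. g (real n)) \<longlonglongrightarrow> 0" using assms by (simp add: D0_def)
  have "(g \<longlongrightarrow> 0) at_top \<and> summable (\<lambda>k. g (real k) - g (x + real k))"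
    using a
  proof
    assume "mono_on {a..} g"
    then show ?thesis
      using lim tendsto_at_top_if_mono_on summable_shift_diff_if_mono_on by blast
  next
    \<comment> \<open>The decreasing case is the increasing one for \<open>-g\<close>.\<close>
    assume "antimono_on {a..} g"
    then have neg: "mono_on {a..} (\<lambda>x. - g x)" by (rule mono_on_uminus_if_antimono_on)
    have lim': "(\<lambda>n::nat. - g (real n)) \<longlonglongrightarrow> 0" using tendsto_minus[OF lim] by simp
    show ?thesis
      using tendsto_minus[OF tendsto_at_top_if_mono_on[OF neg lim']]
        summable_minus[OF summable_shift_diff_if_mono_on[OF neg lim', of x]]
      by simp
  qed
  then show "(g \<longlongrightarrow> 0) at_top" "summable (\<lambda>k. g (real k) - g (x + real k))" by auto
qed

lemma D0_K0_shift_tendsto_0: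
  assumes "g \<in> D0 \<inter> K0"
  shows "(\<lambda>n::nat. g (x + real n)) \<longlonglongrightarrow> 0"
  by (intro filterlim_compose[OF D0_K0_tendsto_0[OF assms]]
      filterlim_tendsto_add_at_top[OF tendsto_const] filterlim_real_sequentially)

section \<open>Differences of values of the principal solution\<close>

lemma Sigma_op_LIMSEQ:
  assumes "g \<in> D0 \<inter> K0"
  shows "(\<lambda>n::nat. - g x + (\<Sum>k\<in>{1..<n}. g (real k) - g (x + real k))) \<longlonglongrightarrow> Sigma_op g x"
proof -
  define s where "s k = g (real k) - g (x + real k)" for k :: nat
  have "(\<lambda>n. \<Sum>k<n. s k) \<longlonglongrightarrow> suminf s"
    unfolding s_def by (rule summable_LIMSEQ[OF D0_K0_summable[OF assms]])
  then have "(\<lambda>n. - g x + ((\<Sum>k<n. s k) - s 0)) \<longlonglongrightarrow> - g x + (suminf s - s 0)"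
    by (intro tendsto_intros)
  \<comment> \<open>For \<open>n = 0\<close> the sum over \<open>{..<n}\<close> has no term \<open>s 0\<close> to remove.\<close>
  moreover have "\<forall>\<^sub>F n in sequentially.
      - g x + ((\<Sum>k<n. s k) - s 0) = - g x + (\<Sum>k\<in>{1..<n}. s k)"
    using eventually_gt_at_top[of 0]
    by eventually_elim (simp add: sum.atLeast_Suc_lessThan flip: atLeast0LessThan)
  ultimately have "(\<lambda>n. - g x + (\<Sum>k\<in>{1..<n}. s k)) \<longlonglongrightarrow> - g x + (suminf s - s 0)"
    by (rule Lim_transform_eventually)
  then show ?thesis
    unfolding Sigma_op_def s_def by (simp add: limI)
qed

lemma Sigma_op_diff_sums:
  assumes "g \<in> D0 \<inter> K0"
  shows "(\<lambda>k. g (y + real k) - g (x + real k)) sums (Sigma_op g x - Sigma_op g y)"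
proof -
  let ?S = "\<lambda>x n. - g x + (\<Sum>k\<in>{1..<n}. g (real k) - g (x + real k))"
  have "(\<lambda>n. ?S x n - ?S y n) \<longlonglongrightarrow> Sigma_op g x - Sigma_op g y"
    by (intro tendsto_diff Sigma_op_LIMSEQ assms)
  moreover have "\<forall>\<^sub>F n in sequentially.
      ?S x n - ?S y n = (\<Sum>k<n. g (y + real k) - g (x + real k))"
    using eventually_gt_at_top[of 0]
    by eventually_elim
      (simp add: sum.atLeast_Suc_lessThan sum_subtractf flip: atLeast0LessThan)
  ultimately show ?thesis
    unfolding sums_def by (rule Lim_transform_eventually)
qed

lemma Sigma_op_add_1:
  assumes "g \<in> D0 \<inter> K0"
  shows "Sigma_op g (x + 1) = Sigma_op g x + g x"
proof -
  have "(\<lambda>k. g (x + real k) - g (x + real (Suc k))) sums (g (x + real 0) - 0)"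
    by (rule telescope_sums'[OF D0_K0_shift_tendsto_0[OF assms]])
  then have "(\<lambda>k. g (x + real k) - g (x + 1 + real k)) sums g x"
    by (simp add: add_ac)
  from sums_unique2[OF this Sigma_op_diff_sums[OF assms]] show ?thesis by simp
qed

section \<open>Symmetric partial sums\<close>

lemma symmetric_sum_eq:
  fixes g :: "real \<Rightarrow> real"
  shows "(\<Sum>k\<in>{- int N..int N}. g (x + of_int k))
    = (\<Sum>k<Suc N. g (x + real k)) + (\<Sum>k<N. g (x - 1 - real k))"
proof (induction N)
  case (Suc N)
  have "{- int (Suc N)..int (Suc N)} = insert (- int (Suc N)) (insert (int (Suc N)) {- int N..int N})"
    by auto
  then show ?case using Suc by (simp add: algebra_simps)
qed simp

lemma symmetric_sum_shift:
  fixes g :: "real \<Rightarrow> real"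
  shows "(\<Sum>k\<in>{- int N..int N}. g (x + 1 + of_int k)) - (\<Sum>k\<in>{- int N..int N}. g (x + of_int k))
    = g (x + 1 + real N) - g (x - real N)"
proof (induction N)
  case (Suc N)
  have "{- int (Suc N)..int (Suc N)} = insert (- int (Suc N)) (insert (int (Suc N)) {- int N..int N})"
    by auto
  then show ?case using Suc by (simp add: algebra_simps)
qed simp

text \<open>
  For odd \<open>g\<close> the reflection \<open>g(1-x+k) = -g(x-1-k)\<close> turns the series for
  \<open>\<Sigma>g(x) - \<Sigma>g(1-x)\<close> into a bilateral one. The two halves have equally many terms, so the
  sums run over \<open>-N, \<dots>, N-1\<close>; the missing term \<open>g(x+N)\<close> tends to \<open>0\<close>.
\<close>

lemma odd_symmetric_sum_LIMSEQ:
  assumes g: "g \<in> D0 \<inter> K0"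
    and odd: "\<And>x. x \<notin> \<int> \<Longrightarrow> g (- x) = - g x" and x: "x \<notin> \<int>"
  shows "(\<lambda>N. \<Sum>k\<in>{- int N..int N}. g (x + of_int k))
    \<longlonglongrightarrow> - (Sigma_op g x - Sigma_op g (1 - x))"
proof -
  have refl: "g (1 - x + real k) = - g (x - 1 - real k)" for k :: nat
  proof -
    have "x - 1 - real k \<notin> \<int>"
      using x Ints_add[of "x - 1 - real k" "1 + real k"] by auto
    from odd[OF this] show ?thesis by (simp add: algebra_simps)
  qed
  have eq: "(\<Sum>k\<in>{- int N..int N}. g (x + of_int k))
      = g (x + real N) - (\<Sum>k<N. g (1 - x + real k) - g (x + real k))" for N
    by (simp only: symmetric_sum_eq refl sum_subtractf sum_negf sum.lessThan_Suc)
  have "(\<lambda>N. g (x + real N) - (\<Sum>k<N. g (1 - x + real k) - g (x + real k)))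
      \<longlonglongrightarrow> 0 - (Sigma_op g x - Sigma_op g (1 - x))"
    using Sigma_op_diff_sums[OF g] unfolding sums_def
    by (intro tendsto_diff D0_K0_shift_tendsto_0[OF g])
  then show ?thesis by (simp add: eq)
qed

lemma odd_tendsto_0_at_bot:
  fixes g :: "real \<Rightarrow> real"
  assumes lim: "(g \<longlongrightarrow> 0) at_top" and odd: "\<And>x. x \<notin> \<int> \<Longrightarrow> g (- x) = - g x"
  shows "(g \<longlongrightarrow> 0) (inf at_bot (principal (- \<int>)))"
proof (rule Lim_transform_eventually)
  have "((\<lambda>x. - g (- x)) \<longlongrightarrow> - 0) at_bot"
    by (intro tendsto_minus filterlim_compose[OF lim] filterlim_uminus_at_top_at_bot)
  then show "((\<lambda>x. - g (- x)) \<longlongrightarrow> 0) (inf at_bot (principal (- \<int>)))"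
    by (simp add: tendsto_mono[OF inf_le1])
  show "\<forall>\<^sub>F x in inf at_bot (principal (- \<int>)). - g (- x) = g x"
    by (simp add: eventually_inf_principal odd)
qed

section \<open>The equivalence\<close>

theorem proposition8p56:
  fixes g \<omega> :: "real \<Rightarrow> real"
  assumes g: "g \<in> D0 \<inter> K0"
    and \<omega>: "\<And>x. x \<notin> \<int> \<Longrightarrow> \<omega> x = Sigma_op g x - Sigma_op g (1 - x)"
  defines "assertion_i \<equiv> (\<forall>x. x \<notin> \<int> \<longrightarrow> g (- x) = - g x)"
    and "assertion_ii \<equiv> (\<forall>x. x \<notin> \<int> \<longrightarrow> \<omega> (x + 1) = \<omega> x)"
    and "assertion_iii \<equiv>
      (g \<longlongrightarrow> 0) (inf at_bot (principal (- \<int>))) \<and>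
      (\<forall>x. x \<notin> \<int> \<longrightarrow>
        (\<lambda>N::nat. \<Sum>k\<in>{- int N..int N}. g (x + of_int k)) \<longlonglongrightarrow> - \<omega> x)"
  shows "(assertion_i \<longleftrightarrow> assertion_ii) \<and> (assertion_ii \<longleftrightarrow> assertion_iii)"
proof -
  have add_1: "x + 1 \<notin> \<int>" if "x \<notin> \<int>" for x :: real
    using that Ints_diff[of "x + 1" 1] by auto
  have step: "\<omega> (x + 1) - \<omega> x = g x + g (- x)" if x: "x \<notin> \<int>" for x
    using Sigma_op_add_1[OF g, of x] Sigma_op_add_1[OF g, of "- x"] \<omega>[OF x] \<omega>[OF add_1[OF x]]
    by simp
  have i_ii: "assertion_i \<longleftrightarrow> assertion_ii"
  proof -
    have "g (- x) = - g x \<longleftrightarrow> \<omega> (x + 1) = \<omega> x" if "x \<notin> \<int>" for x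
      using step[OF that] by linarith
    then show ?thesis unfolding assertion_i_def assertion_ii_def by blast
  qed
  have i_iii: "assertion_iii" if "assertion_i"
  proof -
    have odd: "g (- x) = - g x" if "x \<notin> \<int>" for x
      using that \<open>assertion_i\<close> by (simp add: assertion_i_def)
    show ?thesis
      unfolding assertion_iii_def
      using odd_tendsto_0_at_bot[OF D0_K0_tendsto_0[OF g] odd]
        odd_symmetric_sum_LIMSEQ[OF g odd] \<omega> by simp
  qed
  have iii_ii: "assertion_ii" if iii: "assertion_iii"
    unfolding assertion_ii_def
  proof (intro allI impI)
    fix x :: real assume x: "x \<notin> \<int>"
    have sums: "(\<lambda>N. \<Sum>k\<in>{- int N..int N}. g (y + of_int k)) \<longlonglongrightarrow> - \<omega> y" if "y \<notin> \<int>" for y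
      using iii that by (simp add: assertion_iii_def)
    have notin: "x - real N \<notin> \<int>" for N :: nat
      using x Ints_add[of "x - real N" "real N"] by auto
    have "filterlim (\<lambda>N::nat. x - real N) at_bot sequentially"
      using filterlim_tendsto_add_at_top[OF tendsto_const[of "- x"] filterlim_real_sequentially]
      by (simp add: filterlim_uminus_at_bot)
    then have "filterlim (\<lambda>N::nat. x - real N) (inf at_bot (principal (- \<int>))) sequentially"
      by (simp add: filterlim_inf filterlim_principal notin)
    then have left: "(\<lambda>N::nat. g (x - real N)) \<longlonglongrightarrow> 0"
      by (rule filterlim_compose[rotated]) (use iii in \<open>simp add: assertion_iii_def\<close>)
    have "(\<lambda>N. g (x + 1 + real N) - g (x - real N)) \<longlonglongrightarrow> - \<omega> (x + 1) - - \<omega> x"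
      using tendsto_diff[OF sums[OF add_1[OF x]] sums[OF x]] by (simp only: symmetric_sum_shift)
    moreover have "(\<lambda>N. g (x + 1 + real N) - g (x - real N)) \<longlonglongrightarrow> 0 - 0"
      by (intro tendsto_diff D0_K0_shift_tendsto_0[OF g] left)
    ultimately have "- \<omega> (x + 1) - - \<omega> x = 0 - 0" by (rule LIMSEQ_unique)
    then show "\<omega> (x + 1) = \<omega> x" by simp
  qed
  show ?thesis using i_ii i_iii iii_ii by blast
qed

end
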